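(* Let $M>0$, $\mu\in(0,2]$, $\beta>0$. Fix an arbitrary sequence $\ell_1,\ldots,\ell_T$ of $\mu$-strongly convex differentiable losses on $[-\tfrac12M,\tfrac12M]$ and expert predictions $y_t(i)\in[-\tfrac12M,\tfrac12M]$, $i\in\{1,\dots,K\}$. Consider the selective sampling protocol defined in the context, in which Algorithm 1 is run with inputs $M$ and $\eta=\frac\mu4$, feedback $g_t=\frac{o_t}{q_{t-1}}\ell_t'(\hat y_t)$ and $\kappa_t=q_t$, and suppose $M\ge\max_t|\ell_t'(\hat y_t)|$. Provided $\max_i\max_t|\hat y_t-y_t(i)|\le M$, for every fixed expert $i^\star$, with $y_t^\star=y_t(i^\star)$, $$\mathbb E\left[\sum_{t=1}^T\big(\ell_t(\hat y_t)-\ell_t(y_t^\star)\big)\right]\le\left(\frac{4M^2(\log K+1)}{\mu^{3/2}\beta}\right)^2+\frac{4M^2(\log K+1)}{\mu},$$ where the expectation is over the random variables $o_1,\ldots,o_T$.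
   Context: A differentiable function $\ell$ is $\mu$-strongly convex on $[-\tfrac12M,\tfrac12M]$ if $\ell(y)-\ell(x)\le (y-x)\ell'(y)-\frac{\mu}{2}(x-y)^2$ for all $x,y$ in that interval. Algorithm 1 (prediction with expert advice, $K$ experts). Inputs $\eta\in(0,\tfrac12]$, $M>0$. Set $\gamma=\eta/M^2$ and $p_1(i)=1/K$ for all $i$. In each round $t=1,\ldots,T$: receive the expert predictions $y_t(1),\ldots,y_t(K)\in\mathbb{R}$; predict $\hat y_t=\sum_{i=1}^K p_t(i)y_t(i)$; receive feedback $g_t\in\mathbb{R}$ and $\kappa_t$; set $\tilde\ell_t(i)=\gamma(y_t(i)-\hat y_t)g_t+\kappa_{t-1}\big(\gamma(y_t(i)-\hat y_t)g_t\big)^2$ (with $\kappa_0=\kappa_1$); set $p_{t+1}(i)\propto\exp\!\big(-\kappa_t\sum_{s=1}^t\tilde\ell_s(i)\big)$, normalized to sum to one over $i$. Selective sampling protocol: in round $t$, after $\hat y_t$ is computed, set $$q_t=\min\Big\{1,\ \beta\Big/\sqrt{\min_i\textstyle\sum_{s=1}^t(\hat y_s-y_s(i))^2}\Big\}$$ (with $q_t=1$ if the minimum is $0$), with $q_0=q_1$; conditionally on the past draw $o_t\in\{0,1\}$ with $o_t=1$ with probability $q_t$ and $o_t=0$ with probability $1-q_t$. The loss $\ell_t$ is observed only if $o_t=1$. Here $\log$ is the natural logarithm. *)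

theory Defs
  imports "HOL-Probability.Probability"
begin

text \<open>The derivative is taken within the set, hence one-sided at the end points of an interval.\<close>

definition strongly_convex_on ::
  "real \<Rightarrow> real set \<Rightarrow> (real \<Rightarrow> real) \<Rightarrow> (real \<Rightarrow> real) \<Rightarrow> bool" where
  "strongly_convex_on \<mu> S f f' \<longleftrightarrow>
     (\<forall>x\<in>S. (f has_real_derivative f' x) (at x within S)) \<and>
     (\<forall>x\<in>S. \<forall>y\<in>S. f y - f x \<le> (y - x) * f' y - \<mu> / 2 * (x - y)\<^sup>2)"

text \<open>Experts are numbered \<open>1, \<dots>, K\<close> and rounds \<open>1, \<dots>, T\<close>; \<open>y t i\<close> is the prediction of expert \<open>i\<close>
  in round \<open>t\<close>. The three functions below describe one round of the algorithm in terms of the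
  predictions \<open>yh\<close> made so far and of the feedback \<open>g\<close>, \<open>\<kappa>\<close> received so far. The weights, and hence
  the prediction, of round \<open>t\<close> depend on \<open>yh\<close>, \<open>g\<close>, \<open>\<kappa>\<close> only at rounds before \<open>t\<close>.\<close>

definition surrogate_loss ::
  "real \<Rightarrow> real \<Rightarrow> (nat \<Rightarrow> nat \<Rightarrow> real) \<Rightarrow> (nat \<Rightarrow> real) \<Rightarrow> (nat \<Rightarrow> real) \<Rightarrow> (nat \<Rightarrow> real) \<Rightarrow>
   nat \<Rightarrow> nat \<Rightarrow> real" where
  "surrogate_loss \<eta> M y yh g \<kappa> t i =
     (let \<gamma> = \<eta> / M\<^sup>2; \<kappa>_prev = (if t = 1 then \<kappa> 1 else \<kappa> (t - 1))
      in \<gamma> * (y t i - yh t) * g t + \<kappa>_prev * (\<gamma> * (y t i - yh t) * g t)\<^sup>2)"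

definition expert_weight ::
  "nat \<Rightarrow> real \<Rightarrow> real \<Rightarrow> (nat \<Rightarrow> nat \<Rightarrow> real) \<Rightarrow> (nat \<Rightarrow> real) \<Rightarrow> (nat \<Rightarrow> real) \<Rightarrow> (nat \<Rightarrow> real) \<Rightarrow>
   nat \<Rightarrow> nat \<Rightarrow> real" where
  "expert_weight K \<eta> M y yh g \<kappa> t i =
     (if t = 1 then 1 / real K
      else exp (- \<kappa> (t - 1) * (\<Sum>s=1..t-1. surrogate_loss \<eta> M y yh g \<kappa> s i)) /
           (\<Sum>j=1..K. exp (- \<kappa> (t - 1) * (\<Sum>s=1..t-1. surrogate_loss \<eta> M y yh g \<kappa> s j))))"

definition expert_prediction ::
  "nat \<Rightarrow> real \<Rightarrow> real \<Rightarrow> (nat \<Rightarrow> nat \<Rightarrow> real) \<Rightarrow> (nat \<Rightarrow> real) \<Rightarrow> (nat \<Rightarrow> real) \<Rightarrow> (nat \<Rightarrow> real) \<Rightarrow>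
   nat \<Rightarrow> real" where
  "expert_prediction K \<eta> M y yh g \<kappa> t = (\<Sum>i=1..K. expert_weight K \<eta> M y yh g \<kappa> t i * y t i)"

text \<open>The sampling probability \<open>q\<^sub>t\<close>. The convention \<open>q\<^sub>0 = q\<^sub>1\<close> is built in through \<open>max 1 t\<close>.\<close>

definition sampling_prob ::
  "nat \<Rightarrow> real \<Rightarrow> (nat \<Rightarrow> nat \<Rightarrow> real) \<Rightarrow> (nat \<Rightarrow> real) \<Rightarrow> nat \<Rightarrow> real" where
  "sampling_prob K \<beta> y yh t =
     (let m = Min ((\<lambda>i. \<Sum>s=1..max 1 t. (yh s - y s i)\<^sup>2) ` {1..K})
      in if m = 0 then 1 else min 1 (\<beta> / sqrt m))"

definition sampled_feedback ::
  "nat \<Rightarrow> real \<Rightarrow> (nat \<Rightarrow> nat \<Rightarrow> real) \<Rightarrow> (nat \<Rightarrow> real \<Rightarrow> real) \<Rightarrow> (nat \<Rightarrow> bool) \<Rightarrow> (nat \<Rightarrow> real) \<Rightarrow>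
   nat \<Rightarrow> real" where
  "sampled_feedback K \<beta> y l' ob yh t =
     of_bool (ob t) / sampling_prob K \<beta> y yh (t - 1) * l' t (yh t)"

text \<open>The predictions when the algorithm is run on the sampled feedback, given the outcomes \<open>ob\<close> of
  the draws. The history passed on in round \<open>t\<close> is cut off before \<open>t\<close>, which makes the recursion
  well-founded without changing the prediction (see \<open>predictions_eq\<close>).\<close>

fun predictions ::
  "nat \<Rightarrow> real \<Rightarrow> real \<Rightarrow> real \<Rightarrow> (nat \<Rightarrow> nat \<Rightarrow> real) \<Rightarrow> (nat \<Rightarrow> real \<Rightarrow> real) \<Rightarrow> (nat \<Rightarrow> bool) \<Rightarrow>
   nat \<Rightarrow> real" where
  "predictions K \<eta> M \<beta> y l' ob t =
     (let yh = (\<lambda>s. if s < t then predictions K \<eta> M \<beta> y l' ob s else 0)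
      in expert_prediction K \<eta> M y yh
           (sampled_feedback K \<beta> y l' ob yh) (sampling_prob K \<beta> y yh) t)"

declare predictions.simps [simp del]

lemma sampling_prob_cong:
  assumes "\<And>s. s \<in> {1..max 1 t} \<Longrightarrow> yh s = yh' s"
  shows "sampling_prob K \<beta> y yh t = sampling_prob K \<beta> y yh' t"
proof -
  have "(\<lambda>i. \<Sum>s=1..max 1 t. (yh s - y s i)\<^sup>2) = (\<lambda>i. \<Sum>s=1..max 1 t. (yh' s - y s i)\<^sup>2)"
    by (intro ext sum.cong refl) (simp only: assms)
  then show ?thesis
    by (simp only: sampling_prob_def)
qed

lemma sampling_prob_nonneg: "\<beta> > 0 \<Longrightarrow> K > 0 \<Longrightarrow> 0 \<le> sampling_prob K \<beta> y yh t"
  and sampling_prob_le_1: "sampling_prob K \<beta> y yh t \<le> 1"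
proof -
  show "sampling_prob K \<beta> y yh t \<le> 1"
    by (simp add: sampling_prob_def Let_def)
  assume "\<beta> > 0" "K > 0"
  define m where "m = Min ((\<lambda>i. \<Sum>s=1..max 1 t. (yh s - y s i)\<^sup>2) ` {1..K})"
  have "m \<in> (\<lambda>i. \<Sum>s=1..max 1 t. (yh s - y s i)\<^sup>2) ` {1..K}"
    unfolding m_def using \<open>K > 0\<close> by (intro Min_in) auto
  then have "m \<ge> 0"
    by (auto intro!: sum_nonneg)
  then show "0 \<le> sampling_prob K \<beta> y yh t"
    unfolding sampling_prob_def Let_def m_def[symmetric] using \<open>\<beta> > 0\<close> by simp
qed

lemma predictions_eq:
  fixes K :: nat and \<eta> M \<beta> :: real and y l' ob
  assumes "t \<ge> 1"
  defines "yh \<equiv> predictions K \<eta> M \<beta> y l' ob"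
  shows "yh t = expert_prediction K \<eta> M y yh
                  (sampled_feedback K \<beta> y l' ob yh) (sampling_prob K \<beta> y yh) t"
proof -
  define yc where "yc = (\<lambda>s. if s < t then yh s else 0)"
  have q: "sampling_prob K \<beta> y yc s = sampling_prob K \<beta> y yh s" if "max 1 s < t" for s
    using that by (intro sampling_prob_cong) (auto simp: yc_def)
  have g: "sampled_feedback K \<beta> y l' ob yc s = sampled_feedback K \<beta> y l' ob yh s"
    if "1 \<le> s" "s < t" for s
    using that q[of "s - 1"] by (simp add: sampled_feedback_def yc_def)
  have sl: "surrogate_loss \<eta> M y yc (sampled_feedback K \<beta> y l' ob yc) (sampling_prob K \<beta> y yc) s i =
        surrogate_loss \<eta> M y yh (sampled_feedback K \<beta> y l' ob yh) (sampling_prob K \<beta> y yh) s i"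
    if "1 \<le> s" "s < t" for s i
  proof -
    have "yc s = yh s" using that by (simp add: yc_def)
    then show ?thesis
      using that g[OF that] q[of 1] q[of "s - 1"] by (simp add: surrogate_loss_def)
  qed
  have "expert_weight K \<eta> M y yc (sampled_feedback K \<beta> y l' ob yc) (sampling_prob K \<beta> y yc) t i =
        expert_weight K \<eta> M y yh (sampled_feedback K \<beta> y l' ob yh) (sampling_prob K \<beta> y yh) t i" for i
  proof (cases "t = 1")
    case True
    then show ?thesis by (simp add: expert_weight_def)
  next
    case False
    have S: "(\<Sum>s=1..t-1. surrogate_loss \<eta> M y yc (sampled_feedback K \<beta> y l' ob yc) (sampling_prob K \<beta> y yc) s i) =
        (\<Sum>s=1..t-1. surrogate_loss \<eta> M y yh (sampled_feedback K \<beta> y l' ob yh) (sampling_prob K \<beta> y yh) s i)" for i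
      by (intro sum.cong refl sl) (use assms(1) in auto)
    have "max 1 (t - 1) < t" using False assms(1) by auto
    then show ?thesis
      unfolding expert_weight_def S using q[of "t - 1"] by simp
  qed
  then have "expert_prediction K \<eta> M y yc (sampled_feedback K \<beta> y l' ob yc) (sampling_prob K \<beta> y yc) t =
        expert_prediction K \<eta> M y yh (sampled_feedback K \<beta> y l' ob yh) (sampling_prob K \<beta> y yh) t"
    by (simp add: expert_prediction_def)
  moreover have "yh t = expert_prediction K \<eta> M y yc (sampled_feedback K \<beta> y l' ob yc) (sampling_prob K \<beta> y yc) t"
    unfolding yh_def yc_def by (subst predictions.simps) (simp add: Let_def)
  ultimately show ?thesis by simp
qed

text \<open>The joint law of the draws of the first \<open>n\<close> rounds (later entries are irrelevant and set to
  \<open>False\<close>). Given the draws \<open>ob\<close> of rounds \<open>1, \<dots>, n\<close>, the next one is Bernoulli with the sampling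
  probability of round \<open>n + 1\<close>, a function of \<open>ob 1, \<dots>, ob n\<close> only.\<close>

fun draws ::
  "nat \<Rightarrow> real \<Rightarrow> real \<Rightarrow> real \<Rightarrow> (nat \<Rightarrow> nat \<Rightarrow> real) \<Rightarrow> (nat \<Rightarrow> real \<Rightarrow> real) \<Rightarrow> nat \<Rightarrow>
   (nat \<Rightarrow> bool) pmf" where
  "draws K \<eta> M \<beta> y l' 0 = return_pmf (\<lambda>_. False)"
| "draws K \<eta> M \<beta> y l' (Suc n) =
     bind_pmf (draws K \<eta> M \<beta> y l' n) (\<lambda>ob.
       map_pmf (\<lambda>b. ob(Suc n := b))
         (bernoulli_pmf (sampling_prob K \<beta> y (predictions K \<eta> M \<beta> y l' ob) (Suc n))))"

end

theory Submission
  imports Defs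
begin

text \<open>
  Algorithm 1 keeps the potential \<open>\<Sum>\<^sub>i exp (- \<kappa>\<^sub>t L\<^sub>t(i))\<close> of the cumulative surrogate losses
  at most \<open>K\<close>, because \<open>exp (- x - x\<^sup>2) \<le> 1 - x\<close> for \<open>\<bar>x\<bar> \<le> 1/2\<close> and the linear terms average to
  zero under the weights. Hence \<open>L\<^sub>T(i) \<ge> - ln K / \<kappa>\<^sub>T\<close> for every expert. With sampled feedback,
  put \<open>Z\<^sub>t = (yh\<^sub>t - y\<^sub>t) l'\<^sub>t - \<gamma> (yh\<^sub>t - y\<^sub>t)\<^sup>2 l'\<^sub>t\<^sup>2\<close> for the fixed expert; this says that the sum of
  \<open>(o\<^sub>t / q\<^sub>t\<^sub>-\<^sub>1) Z\<^sub>t\<close> is at most \<open>ln K / (\<gamma> q\<^sub>T)\<close>. In expectation \<open>o\<^sub>t\<close> may be replaced by \<open>q\<^sub>t\<close>, and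
  since \<open>Z\<^sub>t \<le> M\<^sup>2\<close> and \<open>1 - q\<^sub>t / q\<^sub>t\<^sub>-\<^sub>1 \<le> 1 / q\<^sub>t - 1 / q\<^sub>t\<^sub>-\<^sub>1\<close>, replacing \<open>q\<^sub>t / q\<^sub>t\<^sub>-\<^sub>1\<close> by 1 costs
  at most \<open>M\<^sup>2 / q\<^sub>T\<close>. Strong convexity bounds \<open>Z\<^sub>t\<close> below by the instantaneous regret plus
  \<open>\<mu> / 4 (yh\<^sub>t - y\<^sub>t)\<^sup>2\<close>, and this quadratic gain absorbs \<open>1 / q\<^sub>T\<close>, which is at most
  \<open>1 + sqrt (\<Sum>\<^sub>t (yh\<^sub>t - y\<^sub>t)\<^sup>2) / \<beta>\<close>.
\<close>

section \<open>Exponential inequalities\<close>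

lemma exp_minus_square_le:
  fixes x :: real
  assumes "\<bar>x\<bar> \<le> 1 / 2"
  shows "exp (- x - x\<^sup>2) \<le> 1 - x"
proof -
  have "- x - x\<^sup>2 \<le> ln (1 - x)"
  proof (cases "x \<le> 0")
    case True
    then show ?thesis
      using ln_one_plus_pos_lower_bound[of "- x"] assms by simp
  next
    case False
    define f where "f = (\<lambda>u::real. ln (1 - u) + u + u\<^sup>2)"
    have "f 0 \<le> f x"
    proof (rule DERIV_nonneg_imp_nondecreasing[where f = f and a = 0 and b = x])
      show "0 \<le> x" using False by simp
      fix u assume u: "0 \<le> u" "u \<le> x"
      then have u2: "u \<le> 1 / 2" using assms by simp
      have "(f has_real_derivative (- 1 / (1 - u) + 1 + 2 * u)) (at u)"
        unfolding f_def using u2 by (auto intro!: derivative_eq_intros)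
      \<comment> \<open>The factored derivative shows where the constant 1/2 comes from: for
        positive \<open>u\<close> below 1 it is nonnegative exactly up to
        \<open>u = 1 / 2\<close>.\<close>
      moreover have "- 1 / (1 - u) + 1 + 2 * u = u * (1 - 2 * u) / (1 - u)"
        using u2 by (simp add: field_simps)
      moreover have "0 \<le> u * (1 - 2 * u) / (1 - u)"
        using u u2 by simp
      ultimately show "\<exists>y. (f has_real_derivative y) (at u) \<and> 0 \<le> y" by metis
    qed
    then show ?thesis by (simp add: f_def)
  qed
  then have "exp (- x - x\<^sup>2) \<le> exp (ln (1 - x))" by simp
  also have "\<dots> = 1 - x" using assms by simp
  finally show ?thesis .
qed

text \<open>Convexity of \<open>exp\<close> between 0 and \<open>u\<close>. It handles a decreasing
  learning rate: scaling an exponent by \<open>a\<close> moves the exponential at most to the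
  interpolation between 1 and its old value.\<close>

lemma exp_mult_le:
  fixes a u :: real
  assumes "0 \<le> a" "a \<le> 1"
  shows "exp (a * u) \<le> 1 - a + a * exp u"
  using convex_onD[OF exp_convex, of a 0 u] assms by simp

section \<open>Expert weights and regret with decreasing rates\<close>

text \<open>At \<open>t = 1\<close> the sums are empty, so the quotient is already the uniform
  weight and the case split disappears.\<close>

lemma expert_weight_eq:
  assumes "t \<ge> 1"
  shows "expert_weight K \<eta> M y yh g \<kappa> t i =
     exp (- \<kappa> (t - 1) * (\<Sum>s=1..t-1. surrogate_loss \<eta> M y yh g \<kappa> s i)) /
     (\<Sum>j=1..K. exp (- \<kappa> (t - 1) * (\<Sum>s=1..t-1. surrogate_loss \<eta> M y yh g \<kappa> s j)))"
  by (auto simp: expert_weight_def)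

lemma
  assumes "t \<ge> 1" "K \<ge> 1"
  shows expert_weight_nonneg: "0 \<le> expert_weight K \<eta> M y yh g \<kappa> t i"
    and sum_expert_weight: "(\<Sum>i=1..K. expert_weight K \<eta> M y yh g \<kappa> t i) = 1"
proof -
  let ?e = "\<lambda>j. exp (- \<kappa> (t - 1) * (\<Sum>s=1..t-1. surrogate_loss \<eta> M y yh g \<kappa> s j))"
  show "0 \<le> expert_weight K \<eta> M y yh g \<kappa> t i"
    unfolding expert_weight_eq[OF assms(1)] by (intro divide_nonneg_nonneg sum_nonneg) auto
  have "0 < (\<Sum>j=1..K. ?e j)"
    using assms(2) by (intro sum_pos) auto
  then show "(\<Sum>i=1..K. expert_weight K \<eta> M y yh g \<kappa> t i) = 1"
    unfolding expert_weight_eq[OF assms(1)] sum_divide_distrib[symmetric] by simp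
qed

lemma expert_prediction_bounds:
  assumes "t \<ge> 1" "K \<ge> 1" and "\<And>i. i \<in> {1..K} \<Longrightarrow> y t i \<in> {a..b}"
  shows "expert_prediction K \<eta> M y yh g \<kappa> t \<in> {a..b}"
proof -
  let ?p = "expert_weight K \<eta> M y yh g \<kappa> t"
  have "a * (\<Sum>i=1..K. ?p i) \<le> expert_prediction K \<eta> M y yh g \<kappa> t"
    unfolding expert_prediction_def sum_distrib_left mult.commute[of a]
    using assms by (intro sum_mono mult_left_mono expert_weight_nonneg) auto
  moreover have "expert_prediction K \<eta> M y yh g \<kappa> t \<le> b * (\<Sum>i=1..K. ?p i)"
    unfolding expert_prediction_def sum_distrib_left mult.commute[of b]
    using assms by (intro sum_mono mult_left_mono expert_weight_nonneg) auto
  ultimately show ?thesis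
    using sum_expert_weight[OF assms(1,2)] by auto
qed

text \<open>Free of randomness, so that it applies to each outcome of the draws. The condition
  \<open>small\<close> uses \<open>\<kappa> (t - 1)\<close> because both the weights and the
  quadratic correction of round \<open>t\<close> are scaled by it.\<close>

lemma expert_regret:
  assumes "K \<ge> 1" and i: "i \<in> {1..K}"
    and pos: "\<And>t. t \<le> T \<Longrightarrow> \<kappa> t > 0"
    and dec: "\<And>t. t < T \<Longrightarrow> \<kappa> (Suc t) \<le> \<kappa> t"
    and init: "\<kappa> 0 = \<kappa> 1"
    and yh: "\<And>t. t \<in> {1..T} \<Longrightarrow> yh t = expert_prediction K \<eta> M y yh g \<kappa> t"
    and small: "\<And>t i. t \<in> {1..T} \<Longrightarrow> i \<in> {1..K} \<Longrightarrow>
           \<bar>\<kappa> (t - 1) * (\<eta> / M\<^sup>2 * (y t i - yh t) * g t)\<bar> \<le> 1 / 2"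
  shows "- ln (real K) / \<kappa> T \<le> (\<Sum>t=1..T. surrogate_loss \<eta> M y yh g \<kappa> t i)"
proof -
  define L where "L = (\<lambda>n i. \<Sum>s=1..n. surrogate_loss \<eta> M y yh g \<kappa> s i)"
  \<comment> \<open>Each potential is taken at its own rate. A step first adds the new loss at the
    old rate \<open>c\<close>, then lowers the rate.\<close>
  have potential: "n \<le> T \<Longrightarrow> (\<Sum>i=1..K. exp (- \<kappa> n * L n i)) \<le> real K" for n
  proof (induction n)
    case 0
    then show ?case by (simp add: L_def)
  next
    case (Suc n)
    define c where "c = \<kappa> n"
    define w where "w = (\<lambda>i. exp (- c * L n i))"
    define x where "x = (\<lambda>i. c * (\<eta> / M\<^sup>2 * (y (Suc n) i - yh (Suc n)) * g (Suc n)))"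
    have c: "c > 0" unfolding c_def using Suc.prems pos[of n] by simp
    have W: "(\<Sum>i=1..K. w i) > 0"
      unfolding w_def using assms(1) by (intro sum_pos) auto
    have "yh (Suc n) = (\<Sum>i=1..K. w i * y (Suc n) i) / (\<Sum>i=1..K. w i)"
      using Suc.prems
      by (subst yh) (simp_all add: expert_prediction_def expert_weight_eq w_def L_def c_def
          sum_divide_distrib)
    then have centred: "(\<Sum>i=1..K. w i * (y (Suc n) i - yh (Suc n))) = 0"
      using W by (simp only: right_diff_distrib sum_subtractf flip: sum_distrib_right) simp
    have "(\<Sum>i=1..K. w i * x i) =
        c * (\<eta> / M\<^sup>2) * g (Suc n) * (\<Sum>i=1..K. w i * (y (Suc n) i - yh (Suc n)))"
      unfolding sum_distrib_left x_def by (intro sum.cong) (auto simp: field_simps)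
    then have wx: "(\<Sum>i=1..K. w i * x i) = 0" using centred by simp
    \<comment> \<open>The quadratic correction carries the factor \<open>\<kappa>_prev\<close>,
      which equals \<open>c\<close>; at \<open>n = 0\<close> this is what \<open>init\<close>
      provides.\<close>
    have loss: "c * surrogate_loss \<eta> M y yh g \<kappa> (Suc n) i = x i + (x i)\<^sup>2" for i
      using init by (auto simp: surrogate_loss_def Let_def x_def c_def power2_eq_square algebra_simps)
    have "(\<Sum>i=1..K. exp (- c * L (Suc n) i)) = (\<Sum>i=1..K. w i * exp (- x i - (x i)\<^sup>2))"
    proof (intro sum.cong refl)
      fix i
      have "- c * L (Suc n) i = - c * L n i + (- x i - (x i)\<^sup>2)"
        using loss[of i] by (simp add: L_def algebra_simps)
      then show "exp (- c * L (Suc n) i) = w i * exp (- x i - (x i)\<^sup>2)"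
        by (simp only: exp_add w_def)
    qed
    also have "\<dots> \<le> (\<Sum>i=1..K. w i * (1 - x i))"
    proof (intro sum_mono mult_left_mono exp_minus_square_le)
      fix i assume "i \<in> {1..K}"
      then show "\<bar>x i\<bar> \<le> 1 / 2" using small[of "Suc n" i] Suc.prems by (simp add: x_def c_def)
    qed (simp add: w_def)
    also have "\<dots> = (\<Sum>i=1..K. w i)"
      using wx by (simp add: right_diff_distrib sum_subtractf)
    also have "\<dots> \<le> real K" using Suc by (simp add: w_def c_def)
    finally have c_bound: "(\<Sum>i=1..K. exp (- c * L (Suc n) i)) \<le> real K" .
    define a where "a = \<kappa> (Suc n) / c"
    have a: "0 \<le> a" "a \<le> 1"
      using c dec[of n] pos[of "Suc n"] Suc.prems by (auto simp: a_def c_def)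
    have "(\<Sum>i=1..K. exp (- \<kappa> (Suc n) * L (Suc n) i)) =
        (\<Sum>i=1..K. exp (a * (- c * L (Suc n) i)))"
      using c by (simp add: a_def)
    \<comment> \<open>Both ends of the interpolation are at most \<open>real K\<close>: one is
      \<open>real K\<close> itself, the other is \<open>c_bound\<close>.\<close>
    also have "\<dots> \<le> (\<Sum>i=1..K. 1 - a + a * exp (- c * L (Suc n) i))"
      by (intro sum_mono exp_mult_le a)
    also have "\<dots> = real K * (1 - a) + a * (\<Sum>i=1..K. exp (- c * L (Suc n) i))"
      by (simp add: sum.distrib sum_distrib_left)
    also have "\<dots> \<le> real K * (1 - a) + a * real K"
      using c_bound a by (intro add_left_mono mult_left_mono) auto
    finally show ?case by (simp add: algebra_simps)
  qed
  have "exp (- \<kappa> T * L T i) \<le> (\<Sum>i=1..K. exp (- \<kappa> T * L T i))"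
    by (rule member_le_sum[OF i]) auto
  also have "\<dots> \<le> real K" using potential by simp
  finally have "- \<kappa> T * L T i \<le> ln (real K)"
    using assms(1) by (subst ln_ge_iff) auto
  then show ?thesis
    using pos[of T] by (simp add: L_def field_simps)
qed

section \<open>Sampling probabilities\<close>

text \<open>The sums of squares grow with \<open>t\<close>, hence so does their minimum
  \<open>m\<close>. The reciprocal of \<open>min 1 (\<beta> / sqrt m)\<close> is the maximum of 1
  and \<open>sqrt m / \<beta>\<close>, which is at most their sum.\<close>

lemma
  assumes "K \<ge> 1" "\<beta> > 0"
  shows sampling_prob_pos: "0 < sampling_prob K \<beta> y yh t"
    and sampling_prob_Suc_le: "sampling_prob K \<beta> y yh (Suc t) \<le> sampling_prob K \<beta> y yh t"
    and inverse_sampling_prob_le: "i \<in> {1..K} \<Longrightarrow>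
      1 / sampling_prob K \<beta> y yh t \<le> 1 + sqrt (\<Sum>s=1..max 1 t. (yh s - y s i)\<^sup>2) / \<beta>"
proof -
  define S where "S = (\<lambda>t i. \<Sum>s=1..max 1 t. (yh s - y s i)\<^sup>2)"
  define m where "m = (\<lambda>t. Min (S t ` {1..K}))"
  have q: "sampling_prob K \<beta> y yh t = (if m t = 0 then 1 else min 1 (\<beta> / sqrt (m t)))" for t
    by (simp add: sampling_prob_def Let_def m_def S_def)
  have S: "S t i \<ge> 0" for t i unfolding S_def by (intro sum_nonneg) auto
  have m: "m t \<ge> 0" for t unfolding m_def using assms S by (subst Min_ge_iff) auto
  show pos: "0 < sampling_prob K \<beta> y yh t"
    using m[of t] assms by (auto simp: q)
  have mono: "m t \<le> m (Suc t)"
    unfolding m_def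
  proof (subst Min_ge_iff; (intro ballI)?)
    fix v assume "v \<in> S (Suc t) ` {1..K}"
    then obtain i where i: "i \<in> {1..K}" "v = S (Suc t) i" by auto
    have "Min (S t ` {1..K}) \<le> S t i" using i by (intro Min_le) auto
    also have "\<dots> \<le> v" unfolding i S_def by (intro sum_mono2) auto
    finally show "Min (S t ` {1..K}) \<le> v" .
  qed (use assms in auto)
  show "sampling_prob K \<beta> y yh (Suc t) \<le> sampling_prob K \<beta> y yh t"
  proof (cases "m t = 0")
    case False
    then have "m t > 0" using m[of t] by simp
    then have "\<beta> / sqrt (m (Suc t)) \<le> \<beta> / sqrt (m t)"
      using mono assms by (intro divide_left_mono) auto
    then show ?thesis using \<open>m t > 0\<close> mono by (auto simp: q)
  qed (auto simp: q)
  assume i: "i \<in> {1..K}"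
  have mS: "m t \<le> S t i" unfolding m_def using i by (intro Min_le) auto
  have "1 / sampling_prob K \<beta> y yh t \<le> 1 + sqrt (m t) / \<beta>"
    using m[of t] assms by (auto simp: q min_def)
  also have "\<dots> \<le> 1 + sqrt (S t i) / \<beta>"
    using mS assms by (intro add_left_mono divide_right_mono) auto
  finally show "1 / sampling_prob K \<beta> y yh t \<le> 1 + sqrt (\<Sum>s=1..max 1 t. (yh s - y s i)\<^sup>2) / \<beta>"
    by (simp add: S_def)
qed

lemma sampling_prob_0: "sampling_prob K \<beta> y yh 0 = sampling_prob K \<beta> y yh 1"
  by (simp add: sampling_prob_def)

section \<open>Dependence on earlier draws only\<close>

text \<open>The index \<open>max 1 (t - 1)\<close> is the one read by \<open>\<kappa>_prev\<close>
  in both of its branches.\<close>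

lemma surrogate_loss_cong:
  assumes "t \<ge> 1" "yh t = yh' t" "g t = g' t" "\<kappa> (max 1 (t - 1)) = \<kappa>' (max 1 (t - 1))"
  shows "surrogate_loss \<eta> M y yh g \<kappa> t i = surrogate_loss \<eta> M y yh' g' \<kappa>' t i"
proof -
  have "(if t = 1 then f 1 else f (t - 1)) = (f (max 1 (t - 1)) :: real)" for f
    using assms(1) by (auto simp: max_def)
  then show ?thesis using assms by (simp only: surrogate_loss_def)
qed

text \<open>The weights of round \<open>t\<close> involve only losses of earlier rounds, and those
  depend on earlier draws and predictions, so strong induction applies.\<close>

lemma predictions_cong:
  assumes "t \<ge> 1" and "\<And>s. s \<in> {1..<t} \<Longrightarrow> ob s = ob' s"
  shows "predictions K \<eta> M \<beta> y l' ob t = predictions K \<eta> M \<beta> y l' ob' t"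
  using assms
proof (induction t rule: less_induct)
  case (less t)
  let ?yh = "predictions K \<eta> M \<beta> y l' ob" and ?yh' = "predictions K \<eta> M \<beta> y l' ob'"
  let ?q = "sampling_prob K \<beta> y ?yh" and ?q' = "sampling_prob K \<beta> y ?yh'"
  let ?g = "sampled_feedback K \<beta> y l' ob ?yh" and ?g' = "sampled_feedback K \<beta> y l' ob' ?yh'"
  have yh: "?yh s = ?yh' s" if "s \<in> {1..<t}" for s
    using that less.prems by (intro less.IH) auto
  have q: "?q s = ?q' s" if "max 1 s < t" for s
    using that by (intro sampling_prob_cong yh) auto
  have loss: "surrogate_loss \<eta> M y ?yh ?g ?q s i = surrogate_loss \<eta> M y ?yh' ?g' ?q' s i"
    if s: "s \<in> {1..t-1}" for s i
  proof (rule surrogate_loss_cong)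
    have st: "s \<in> {1..<t}" using s by auto
    show "?yh s = ?yh' s" by (rule yh[OF st])
    have "max 1 (s - 1) < t" using st by auto
    then show "?q (max 1 (s - 1)) = ?q' (max 1 (s - 1))" by (intro q) auto
    have "?q (s - 1) = ?q' (s - 1)" using st by (intro q) auto
    then show "?g s = ?g' s"
      using yh[OF st] less.prems(2)[OF st] by (simp add: sampled_feedback_def)
  qed (use s in auto)
  have "expert_weight K \<eta> M y ?yh ?g ?q t i = expert_weight K \<eta> M y ?yh' ?g' ?q' t i" for i
  proof (cases "t = 1")
    case False
    then have "?q (t - 1) = ?q' (t - 1)" using less.prems(1) by (intro q) auto
    moreover have "(\<Sum>s=1..t-1. surrogate_loss \<eta> M y ?yh ?g ?q s i) =
        (\<Sum>s=1..t-1. surrogate_loss \<eta> M y ?yh' ?g' ?q' s i)" for i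
      by (intro sum.cong refl loss)
    ultimately show ?thesis by (simp only: expert_weight_def)
  qed (simp add: expert_weight_def)
  then have "expert_prediction K \<eta> M y ?yh ?g ?q t = expert_prediction K \<eta> M y ?yh' ?g' ?q' t"
    by (simp add: expert_prediction_def)
  then show ?case
    by (simp only: predictions_eq[OF less.prems(1)])
qed

text \<open>The prediction of round \<open>t\<close> enters here, but it is fixed before the draw of
  that round. At \<open>t = 0\<close> only the prediction of round 1 is read, which depends on no
  draw.\<close>

lemma sampling_prob_predictions_cong:
  assumes "\<And>s. s \<in> {1..<t} \<Longrightarrow> ob s = ob' s"
  shows "sampling_prob K \<beta> y (predictions K \<eta> M \<beta> y l' ob) t =
    sampling_prob K \<beta> y (predictions K \<eta> M \<beta> y l' ob') t"
  using assms by (intro sampling_prob_cong predictions_cong) auto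

section \<open>Expectation over the draws\<close>

lemma finite_set_pmf_draws: "finite (set_pmf (draws K \<eta> M \<beta> y l' n))"
  by (induction n) auto

lemma expectation_draws_Suc:
  fixes f :: "(nat \<Rightarrow> bool) \<Rightarrow> real" and K :: nat and \<eta> M \<beta> :: real and y l'
  assumes "K > 0" "\<beta> > 0"
  defines "q \<equiv> (\<lambda>ob. sampling_prob K \<beta> y (predictions K \<eta> M \<beta> y l' ob))"
  shows "measure_pmf.expectation (draws K \<eta> M \<beta> y l' (Suc n)) f =
    measure_pmf.expectation (draws K \<eta> M \<beta> y l' n)
      (\<lambda>ob. q ob (Suc n) * f (ob(Suc n := True)) + (1 - q ob (Suc n)) * f (ob(Suc n := False)))"
proof -
  let ?A = "set_pmf (draws K \<eta> M \<beta> y l' n)"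
  have fin: "finite ?A" by (rule finite_set_pmf_draws)
  have q: "0 \<le> q ob t" "q ob t \<le> 1" for ob t
    using assms sampling_prob_nonneg[of \<beta> K] sampling_prob_le_1[of K] by auto
  have "measure_pmf.expectation (draws K \<eta> M \<beta> y l' (Suc n)) f =
    (\<Sum>ob\<in>?A. pmf (draws K \<eta> M \<beta> y l' n) ob *\<^sub>R measure_pmf.expectation
      (map_pmf (\<lambda>b. ob(Suc n := b)) (bernoulli_pmf (q ob (Suc n)))) f)"
    unfolding draws.simps q_def by (rule pmf_expectation_bind[OF fin]) auto
  also have "\<dots> = (\<Sum>ob\<in>?A. pmf (draws K \<eta> M \<beta> y l' n) ob *\<^sub>R
      (q ob (Suc n) * f (ob(Suc n := True)) + (1 - q ob (Suc n)) * f (ob(Suc n := False))))"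
    using q by (simp add: mult_ac)
  also have "\<dots> = measure_pmf.expectation (draws K \<eta> M \<beta> y l' n)
      (\<lambda>ob. q ob (Suc n) * f (ob(Suc n := True)) + (1 - q ob (Suc n)) * f (ob(Suc n := False)))"
    by (rule integral_measure_pmf[OF fin, symmetric]) (auto simp: set_pmf_eq)
  finally show ?thesis .
qed

text \<open>A martingale argument: \<open>W t\<close> is determined by the draws before round
  \<open>t\<close>, and given these the draw has mean \<open>q ob t\<close>.\<close>

lemma expectation_draws_predictable:
  fixes W :: "nat \<Rightarrow> (nat \<Rightarrow> bool) \<Rightarrow> real" and K :: nat and \<eta> M \<beta> :: real and y l'
  assumes "K > 0" "\<beta> > 0"
    and W: "\<And>t ob ob'. t \<ge> 1 \<Longrightarrow> (\<And>s. s \<in> {1..<t} \<Longrightarrow> ob s = ob' s) \<Longrightarrow> W t ob = W t ob'"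
  defines "q \<equiv> (\<lambda>ob. sampling_prob K \<beta> y (predictions K \<eta> M \<beta> y l' ob))"
  shows "measure_pmf.expectation (draws K \<eta> M \<beta> y l' n)
           (\<lambda>ob. \<Sum>t=1..n. (q ob t - of_bool (ob t)) * W t ob) = 0"
proof (induction n)
  case 0
  then show ?case by simp
next
  case (Suc n)
  define N where "N = (\<lambda>n ob. \<Sum>t=1..n. (q ob t - of_bool (ob t)) * W t ob)"
  have upd: "q (ob(Suc n := b)) t = q ob t" "W t (ob(Suc n := b)) = W t ob"
    if "t \<in> {1..Suc n}" for ob b t
    unfolding q_def using that by (auto intro!: sampling_prob_predictions_cong W)
  have past: "N n (ob(Suc n := b)) = N n ob" for ob b
    unfolding N_def by (intro sum.cong refl) (simp_all add: upd)
  have "N (Suc n) (ob(Suc n := b)) = N n ob + (q ob (Suc n) - of_bool b) * W (Suc n) ob" for ob b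
  proof -
    have "N (Suc n) ob' = N n ob' + (q ob' (Suc n) - of_bool (ob' (Suc n))) * W (Suc n) ob'" for ob'
      by (simp add: N_def)
    then show ?thesis by (simp add: past upd)
  qed
  \<comment> \<open>The increments \<open>(q - 1) * W\<close> and \<open>q * W\<close> occur with
    probabilities \<open>q\<close> and \<open>1 - q\<close> and cancel on average.\<close>
  then have "q ob (Suc n) * N (Suc n) (ob(Suc n := True)) +
      (1 - q ob (Suc n)) * N (Suc n) (ob(Suc n := False)) = N n ob" for ob
    by (simp only:) (simp add: algebra_simps)
  then have "measure_pmf.expectation (draws K \<eta> M \<beta> y l' (Suc n)) (N (Suc n)) =
      measure_pmf.expectation (draws K \<eta> M \<beta> y l' n) (N n)"
    by (subst expectation_draws_Suc[OF assms(1,2)]) (simp add: q_def)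
  then show ?case using Suc by (simp add: N_def)
qed

section \<open>Regret under selective sampling\<close>

theorem theorem20:
  fixes M \<mu> \<beta> :: real and K T :: nat and istar :: nat
    and l l' :: "nat \<Rightarrow> real \<Rightarrow> real" and y :: "nat \<Rightarrow> nat \<Rightarrow> real"
  assumes "M > 0" and "0 < \<mu>" and "\<mu> \<le> 2" and "\<beta> > 0"
    and "\<And>t. t \<in> {1..T} \<Longrightarrow> strongly_convex_on \<mu> {- M / 2..M / 2} (l t) (l' t)"
    and "\<And>t i. t \<in> {1..T} \<Longrightarrow> i \<in> {1..K} \<Longrightarrow> y t i \<in> {- M / 2..M / 2}"
    and "\<And>ob t. ob \<in> set_pmf (draws K (\<mu> / 4) M \<beta> y l' T) \<Longrightarrow> t \<in> {1..T} \<Longrightarrow>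
           \<bar>l' t (predictions K (\<mu> / 4) M \<beta> y l' ob t)\<bar> \<le> M"
    and "\<And>ob t i. ob \<in> set_pmf (draws K (\<mu> / 4) M \<beta> y l' T) \<Longrightarrow> t \<in> {1..T} \<Longrightarrow> i \<in> {1..K} \<Longrightarrow>
           \<bar>predictions K (\<mu> / 4) M \<beta> y l' ob t - y t i\<bar> \<le> M"
    and "istar \<in> {1..K}"
  shows "measure_pmf.expectation (draws K (\<mu> / 4) M \<beta> y l' T)
           (\<lambda>ob. \<Sum>t=1..T. l t (predictions K (\<mu> / 4) M \<beta> y l' ob t) - l t (y t istar))
         \<le> (4 * M\<^sup>2 * (ln (real K) + 1) / (\<mu> powr (3 / 2) * \<beta>))\<^sup>2
           + 4 * M\<^sup>2 * (ln (real K) + 1) / \<mu>"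
\<comment> \<open>\<open>sampling_prob\<close> sums up to \<open>max 1 t\<close>, so at
  \<open>T = 0\<close> it would bring in round 1, which the regret does not contain.\<close>
proof (cases "T = 0")
  case True
  then show ?thesis using assms by simp
next
  case False
  define D where "D = draws K (\<mu> / 4) M \<beta> y l' T"
  define yh where "yh = predictions K (\<mu> / 4) M \<beta> y l'"
  define q where "q = (\<lambda>ob. sampling_prob K \<beta> y (yh ob))"
  define g where "g = (\<lambda>ob. sampled_feedback K \<beta> y l' ob (yh ob))"
  define \<gamma> where "\<gamma> = \<mu> / 4 / M\<^sup>2"
  define d where "d = (\<lambda>ob t. yh ob t - y t istar)"
  define Z where "Z = (\<lambda>t ob. d ob t * l' t (yh ob t) - \<gamma> * (d ob t)\<^sup>2 * (l' t (yh ob t))\<^sup>2)"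
  \<comment> \<open>The martingale that accounts for replacing each draw by its conditional
    probability.\<close>
  define N where "N = (\<lambda>ob. \<Sum>t=1..T. (q ob t - of_bool (ob t)) * (Z t ob / q ob (t - 1)))"
  \<comment> \<open>The second summand of the claimed bound; the first will appear as
    \<open>a\<^sup>2 / (\<beta>\<^sup>2 * \<mu>)\<close>.\<close>
  define a where "a = 4 * M\<^sup>2 * (ln (real K) + 1) / \<mu>"
  have K: "K \<ge> 1" using assms(9) by auto
  have \<gamma>: "\<gamma> > 0" unfolding \<gamma>_def using assms by simp
  have \<gamma>M: "\<gamma> * M\<^sup>2 = \<mu> / 4" unfolding \<gamma>_def using assms by simp
  have q_pos: "q ob t > 0" and q_le: "q ob t \<le> 1" and q_dec: "q ob (Suc t) \<le> q ob t" for ob t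
    unfolding q_def using K assms(4)
    by (auto intro: sampling_prob_pos sampling_prob_le_1 sampling_prob_Suc_le)
  have a: "a \<ge> 0" unfolding a_def using assms K by simp

  have "measure_pmf.expectation D N = 0"
    unfolding N_def D_def q_def yh_def
  proof (rule expectation_draws_predictable)
    fix t :: nat and ob ob' :: "nat \<Rightarrow> bool" assume t: "1 \<le> t" and eq: "\<And>s. s \<in> {1..<t} \<Longrightarrow> ob s = ob' s"
    have "yh ob t = yh ob' t" unfolding yh_def by (intro predictions_cong t eq)
    moreover have "q ob (t - 1) = q ob' (t - 1)"
      unfolding q_def yh_def by (intro sampling_prob_predictions_cong eq) auto
    ultimately show "Z t ob / sampling_prob K \<beta> y (predictions K (\<mu> / 4) M \<beta> y l' ob) (t - 1) =
        Z t ob' / sampling_prob K \<beta> y (predictions K (\<mu> / 4) M \<beta> y l' ob') (t - 1)"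
      by (simp add: Z_def d_def q_def yh_def)
  qed (use K assms in auto)
  \<comment> \<open>Only outcomes in the support are treated, since the bounds by \<open>M\<close>
    on derivatives and deviations are assumed there alone.\<close>
  moreover have pathwise: "(\<Sum>t=1..T. l t (yh ob t) - l t (y t istar)) \<le> N ob + (a\<^sup>2 / (\<beta>\<^sup>2 * \<mu>) + a)"
    if ob: "ob \<in> set_pmf D" for ob
  proof -
    let ?l = "\<lambda>t. l' t (yh ob t)"
    have l: "\<bar>?l t\<bar> \<le> M" if "t \<in> {1..T}" for t
      using assms(7) ob that by (simp add: D_def yh_def)
    have yM: "\<bar>yh ob t - y t i\<bar> \<le> M" if "t \<in> {1..T}" "i \<in> {1..K}" for t i
      using assms(8) ob that by (simp add: D_def yh_def)
    have pred: "yh ob t = expert_prediction K (\<mu> / 4) M y (yh ob) (g ob) (q ob) t"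
      if "t \<ge> 1" for t
      using predictions_eq[OF that] by (simp add: yh_def g_def q_def)
    \<comment> \<open>The rate cancels the importance weight, so the condition \<open>small\<close>
      holds however small the sampling probabilities become.\<close>
    have gq: "q ob (t - 1) * g ob t = of_bool (ob t) * ?l t" for t
      using q_pos[of ob "t - 1"] by (simp add: g_def sampled_feedback_def q_def)

    have "- ln (real K) / q ob T \<le> (\<Sum>t=1..T. surrogate_loss (\<mu> / 4) M y (yh ob) (g ob) (q ob) t istar)"
    proof (rule expert_regret[OF K assms(9)])
      show "q ob 0 = q ob 1" by (simp only: q_def sampling_prob_0)
      fix t i assume t: "t \<in> {1..T}" and i: "i \<in> {1..K}"
      have "\<bar>q ob (t - 1) * (\<mu> / 4 / M\<^sup>2 * (y t i - yh ob t) * g ob t)\<bar> =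
          \<bar>\<gamma> * (y t i - yh ob t) * (q ob (t - 1) * g ob t)\<bar>"
        by (simp add: \<gamma>_def mult_ac)
      also have "\<dots> = \<gamma> * (\<bar>yh ob t - y t i\<bar> * \<bar>of_bool (ob t) * ?l t\<bar>)"
        unfolding gq using \<gamma> by (simp add: abs_mult abs_minus_commute)
      also have "\<dots> \<le> \<gamma> * (M * M)"
        using \<gamma> yM[OF t i] l[OF t] assms(1) by (intro mult_left_mono mult_mono) auto
      also have "\<dots> \<le> 1 / 2" using \<gamma>M assms(3) by (simp add: power2_eq_square)
      finally show "\<bar>q ob (t - 1) * (\<mu> / 4 / M\<^sup>2 * (y t i - yh ob t) * g ob t)\<bar> \<le> 1 / 2" .
    qed (use q_pos q_dec pred in auto)
    also have "(\<Sum>t=1..T. surrogate_loss (\<mu> / 4) M y (yh ob) (g ob) (q ob) t istar) =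
        (\<Sum>t=1..T. - \<gamma> * (of_bool (ob t) * (Z t ob / q ob (t - 1))))"
    proof (rule sum.cong[OF refl])
      fix t assume t: "t \<in> {1..T}"
      have g: "g ob t = of_bool (ob t) * ?l t / q ob (t - 1)"
        by (simp add: g_def sampled_feedback_def q_def)
      have qp: "q ob (t - 1) > 0" by (rule q_pos)
      have "surrogate_loss (\<mu> / 4) M y (yh ob) (g ob) (q ob) t istar =
          - (\<gamma> * d ob t * g ob t) + q ob (t - 1) * (\<gamma> * d ob t * g ob t)\<^sup>2"
      proof -
        have "(if t = 1 then q ob 1 else q ob (t - 1)) = q ob (t - 1)"
          using sampling_prob_0[of K \<beta> y "yh ob"] by (simp add: q_def)
        then show ?thesis
          unfolding surrogate_loss_def Let_def \<gamma>_def[symmetric] d_def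
          by (simp only:) (simp add: power2_eq_square algebra_simps)
      qed
      \<comment> \<open>A draw is 0 or 1 and equals its square, and the factor
        \<open>q ob (t - 1)\<close> cancels one power of the squared weight. Hence both terms scale
        alike and \<open>Z\<close> factors out.\<close>
      also have "\<dots> = - \<gamma> * (of_bool (ob t) * (Z t ob / q ob (t - 1)))"
        unfolding g Z_def using qp by (cases "ob t") (auto simp: field_simps power2_eq_square)
      finally show "surrogate_loss (\<mu> / 4) M y (yh ob) (g ob) (q ob) t istar =
          - \<gamma> * (of_bool (ob t) * (Z t ob / q ob (t - 1)))" .
    qed
    finally have "\<gamma> * (\<Sum>t=1..T. of_bool (ob t) * (Z t ob / q ob (t - 1))) \<le> ln (real K) / q ob T"
      by (simp add: sum_negf sum_distrib_left)
    then have "\<gamma> * (\<Sum>t=1..T. of_bool (ob t) * (Z t ob / q ob (t - 1))) / \<gamma> \<le>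
        ln (real K) / q ob T / \<gamma>"
      using \<gamma> by (intro divide_right_mono) auto
    moreover have "ln (real K) / q ob T / \<gamma> = ln (real K) / \<gamma> * (1 / q ob T)" by simp
    ultimately have sampled: "(\<Sum>t=1..T. of_bool (ob t) * (Z t ob / q ob (t - 1))) \<le>
        ln (real K) / \<gamma> * (1 / q ob T)"
      using nonzero_mult_div_cancel_left[of \<gamma>] less_imp_neq[OF \<gamma>, symmetric] by (simp only: not_False_eq_True)

    have Z_upper: "Z t ob \<le> M\<^sup>2" if t: "t \<in> {1..T}" for t
    proof -
      have "d ob t * ?l t \<le> \<bar>d ob t\<bar> * \<bar>?l t\<bar>" by (simp flip: abs_mult)
      also have "\<dots> \<le> M * M"
        using yM[OF t assms(9)] l[OF t] assms(1) unfolding d_def by (intro mult_mono) auto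
      moreover have "\<gamma> * (d ob t)\<^sup>2 * (?l t)\<^sup>2 \<ge> 0" using \<gamma> by simp
      ultimately show ?thesis unfolding Z_def power2_eq_square[of M] by linarith
    qed
    have Z_lower: "l t (yh ob t) - l t (y t istar) + \<mu> / 4 * (d ob t)\<^sup>2 \<le> Z t ob"
      if t: "t \<in> {1..T}" for t
    proof -
      have "yh ob t \<in> {- M / 2..M / 2}"
        using t by (subst pred; (intro expert_prediction_bounds K assms(6))?) auto
      then have "l t (yh ob t) - l t (y t istar) \<le> d ob t * ?l t - \<mu> / 2 * (d ob t)\<^sup>2"
        using assms(5)[OF t] assms(6)[OF t assms(9)] unfolding strongly_convex_on_def d_def
        by (metis power2_commute)
      \<comment> \<open>The quadratic part of \<open>Z\<close> uses up \<open>\<mu> / 4\<close> of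
        the \<open>\<mu> / 2\<close> supplied by strong convexity.\<close>
      moreover have "\<gamma> * (d ob t)\<^sup>2 * (?l t)\<^sup>2 \<le> \<gamma> * (d ob t)\<^sup>2 * M\<^sup>2"
        using l[OF t] \<gamma> assms(1) by (intro mult_left_mono) (auto simp: abs_le_square_iff[symmetric])
      moreover have "\<gamma> * (d ob t)\<^sup>2 * M\<^sup>2 = \<mu> / 4 * (d ob t)\<^sup>2"
        using \<gamma>M by (simp add: mult_ac)
      ultimately show ?thesis unfolding Z_def by linarith
    qed
    have gap: "Z t ob - q ob t * (Z t ob / q ob (t - 1)) \<le> M\<^sup>2 * (1 / q ob t - 1 / q ob (t - 1))"
      if t: "t \<in> {1..T}" for t
    proof -
      have dec: "q ob t \<le> q ob (t - 1)" using q_dec[of ob "t - 1"] t by simp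
      have "Z t ob - q ob t * (Z t ob / q ob (t - 1)) = Z t ob * (1 - q ob t / q ob (t - 1))"
        by (simp add: algebra_simps)
      also have "\<dots> \<le> M\<^sup>2 * (1 - q ob t / q ob (t - 1))"
        using Z_upper[OF t] dec q_pos[of ob "t - 1"] by (intro mult_right_mono) auto
      \<comment> \<open>Factoring out \<open>q ob t\<close>, which is at most 1, turns the relative
        decrease into a telescoping difference of reciprocals.\<close>
      also have "1 - q ob t / q ob (t - 1) = q ob t * (1 / q ob t - 1 / q ob (t - 1))"
        using q_pos[of ob t] by (simp add: right_diff_distrib)
      also have "\<dots> \<le> 1 * (1 / q ob t - 1 / q ob (t - 1))"
        using dec q_pos q_le by (intro mult_right_mono) (auto simp: frac_le)
      finally show ?thesis by (simp add: mult_left_mono)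
    qed
    have telescope: "(\<Sum>t=1..T. 1 / q ob t - 1 / q ob (t - 1)) = 1 / q ob T - 1 / q ob 0"
      by (induction T) auto

    define S where "S = (\<Sum>t=1..T. (d ob t)\<^sup>2)"
    have S: "S \<ge> 0" unfolding S_def by (intro sum_nonneg) auto
    have "(\<Sum>t=1..T. l t (yh ob t) - l t (y t istar)) + \<mu> / 4 * S \<le> (\<Sum>t=1..T. Z t ob)"
      unfolding S_def sum_distrib_left sum.distrib[symmetric] by (intro sum_mono Z_lower)
    also have "\<dots> = N ob + (\<Sum>t=1..T. of_bool (ob t) * (Z t ob / q ob (t - 1))) +
        (\<Sum>t=1..T. Z t ob - q ob t * (Z t ob / q ob (t - 1)))"
      unfolding N_def sum.distrib[symmetric] by (intro sum.cong refl) (simp only: left_diff_distrib)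
    also have "\<dots> \<le> N ob + ln (real K) / \<gamma> * (1 / q ob T) +
        (\<Sum>t=1..T. M\<^sup>2 * (1 / q ob t - 1 / q ob (t - 1)))"
      by (intro add_mono sampled sum_mono gap order_refl)
    also have "\<dots> \<le> N ob + ln (real K) / \<gamma> * (1 / q ob T) + M\<^sup>2 * (1 / q ob T)"
      unfolding sum_distrib_left[symmetric] telescope using q_pos[of ob 0]
      by (intro add_left_mono mult_left_mono) auto
    also have "\<dots> \<le> N ob + a * (1 / q ob T)"
    proof -
      \<comment> \<open>This gives \<open>M\<^sup>2 \<le> 4 * M\<^sup>2 / \<mu>\<close>, so the
        telescoping cost becomes the \<open>+ 1\<close> next to \<open>ln (real K)\<close> in
        \<open>a\<close>.\<close>
      have "\<mu> * M\<^sup>2 \<le> 4 * M\<^sup>2" using assms(3) by (intro mult_right_mono) auto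
      then have "ln (real K) / \<gamma> + M\<^sup>2 \<le> a"
        unfolding a_def \<gamma>_def using assms(1,2) by (simp add: field_simps)
      then have "(ln (real K) / \<gamma> + M\<^sup>2) * (1 / q ob T) \<le> a * (1 / q ob T)"
        using q_pos[of ob T] by (intro mult_right_mono) auto
      then show ?thesis by (simp only: distrib_right add.assoc add_le_cancel_left)
    qed
    also have "\<dots> \<le> N ob + a * (1 + sqrt S / \<beta>)"
      using inverse_sampling_prob_le[OF K assms(4,9), of y "yh ob" T] False a
      by (intro add_left_mono mult_left_mono) (auto simp: q_def S_def d_def max_def)
    finally have "(\<Sum>t=1..T. l t (yh ob t) - l t (y t istar)) \<le>
        N ob + a + (a / \<beta> * sqrt S - \<mu> / 4 * S)"
      by (simp add: algebra_simps)
    also have "a / \<beta> * sqrt S - \<mu> / 4 * S \<le> a\<^sup>2 / (\<beta>\<^sup>2 * \<mu>)"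
    proof -
      \<comment> \<open>Completing the square in \<open>sqrt S\<close>.\<close>
      have "0 \<le> (a / \<beta> - \<mu> / 2 * sqrt S)\<^sup>2 / \<mu>" using assms(2) by simp
      also have "\<dots> = a\<^sup>2 / (\<beta>\<^sup>2 * \<mu>) - a / \<beta> * sqrt S + \<mu> / 4 * (sqrt S)\<^sup>2"
        using assms(2,4) by (simp add: field_simps power2_eq_square)
      finally show ?thesis using S by simp
    qed
    finally show ?thesis by (simp add: algebra_simps)
  qed
  moreover have fin: "finite (set_pmf D)" unfolding D_def by (rule finite_set_pmf_draws)
  moreover have "measure_pmf.expectation D (\<lambda>ob. \<Sum>t=1..T. l t (yh ob t) - l t (y t istar)) \<le>
      measure_pmf.expectation D (\<lambda>ob. N ob + (a\<^sup>2 / (\<beta>\<^sup>2 * \<mu>) + a))"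
    by (intro integral_mono_AE integrable_measure_pmf_finite fin AE_pmfI pathwise)
  ultimately have "measure_pmf.expectation D (\<lambda>ob. \<Sum>t=1..T. l t (yh ob t) - l t (y t istar)) \<le>
      a\<^sup>2 / (\<beta>\<^sup>2 * \<mu>) + a"
    by (simp add: integrable_measure_pmf_finite)
  also have "a\<^sup>2 / (\<beta>\<^sup>2 * \<mu>) = (4 * M\<^sup>2 * (ln (real K) + 1) / (\<mu> powr (3 / 2) * \<beta>))\<^sup>2"
  proof -
    \<comment> \<open>The square of \<open>a\<close> contributes two powers of \<open>\<mu>\<close>
      in the denominator and the completed square a third, hence the exponent 3/2.\<close>
    have "(\<mu> powr (3 / 2))\<^sup>2 = \<mu> ^ 3"
      using assms(2) by (simp add: powr_power powr_numeral)
    then show ?thesis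
      unfolding a_def by (simp add: power_divide power_mult_distrib power2_eq_square power3_eq_cube)
  qed
  finally show ?thesis by (simp add: D_def yh_def a_def)
qed

end
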